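(* Let $r$ be a non-negative integer and $n,k,\lambda$ positive integers with $r\le n\le k$. Let $\boldsymbol\rho=(\rho_1,\dots,\rho_k)$ be a $k$-tuple of integers with $1\le\rho_\ell\le\lambda n$ for each $\ell\in[k]$ and $\sum_{\ell\in[k]}\rho_\ell=\lambda n^2$. A simple $r\times n$ $(\boldsymbol\rho,\lambda)$-Latin rectangle $M$ can be extended to a simple $n\times n$ $(\boldsymbol\rho,\lambda)$-Latin square if and only if $\lambda\le k$ and \begin{align*} &\rho_\ell-|M_\ell|\le\lambda(n-r) &&\text{for all }\ell\in[k],\\ &\lambda(n-r)\le\sum_{\ell\in[k]}\min\{n-r,\lambda-|{}^jM_\ell|\} &&\text{for all }j\in[n],\\ &\rho_\ell-|M_\ell|\le\sum_{j\in[n]}\min\{n-r,\lambda-|{}^jM_\ell|\} &&\text{for all }\ell\in[k],\\ &\sum_{j\in[n]}\Big(\lambda(n-r)\,\dot{-}\,\sum_{\ell\in K}\min\{n-r,\lambda-|{}^jM_\ell|\}\Big)\le\sum_{\ell\in\bar K}\big(\rho_\ell-|M_\ell|\big) &&\text{for all }K\subseteq[k]. \end{align*}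
   Context: Notation: $[m]=\{1,\dots,m\}$ (so $[0]=\varnothing$); $x\,\dot{-}\,y:=\max\{0,x-y\}$; for $K\subseteq[k]$, $\bar K=[k]\setminus K$. An $r\times s$ $\lambda$-matrix $M$ on the symbol set $[k]$ is an $r\times s$ array in which each cell contains a multiset of exactly $\lambda$ elements of $[k]$. For $\ell\in[k]$, $|M_\ell|$, $|M^i_\ell|$, $|{}^jM_\ell|$ denote the number of occurrences (with multiplicity) of $\ell$ in $M$, in row $i$ of $M$, and in column $j$ of $M$. An $n\times n$ $(\boldsymbol\rho,\lambda)$-Latin square is an $n\times n$ $\lambda$-matrix $N$ on $[k]$ with $|N_\ell|=\rho_\ell$, $|N^i_\ell|\le\lambda$, $|{}^jN_\ell|\le\lambda$ for all $\ell\in[k]$, $i,j\in[n]$. An $r\times n$ $(\boldsymbol\rho,\lambda)$-Latin rectangle is an $r\times n$ $\lambda$-matrix $M$ on $[k]$ with $|M_\ell|\le\rho_\ell$, $|M^i_\ell|\le\lambda$, $|{}^jM_\ell|\le\lambda$ for all $\ell\in[k]$, $i\in[r]$, $j\in[n]$. Such a square or rectangle is simple if each symbol occurs at most once in each cell. $M$ is extended to $N$ if $M$ consists of the first $r$ rows of $N$. *)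

theory Defs
  imports "HOL-Library.Multiset"
begin

text \<open>
  An \<open>r \<times> s\<close> array of multisets is a function of the row and the column index.  Rows, columns and
  symbols are numbered from 1, and entries outside \<open>{1..r} \<times> {1..s}\<close> carry no meaning: no notion
  below looks at them.  Likewise a tuple \<open>(\<rho>\<^sub>1, \<dots>, \<rho>\<^sub>k)\<close> is a function read only on \<open>{1..k}\<close>.
\<close>

type_synonym mset_array = "nat \<Rightarrow> nat \<Rightarrow> nat multiset"

definition lambda_matrix :: "nat \<Rightarrow> nat \<Rightarrow> nat \<Rightarrow> nat \<Rightarrow> mset_array \<Rightarrow> bool" where
  "lambda_matrix r s k lam M \<longleftrightarrow>
     (\<forall>i\<in>{1..r}. \<forall>j\<in>{1..s}. size (M i j) = lam \<and> set_mset (M i j) \<subseteq> {1..k})"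

text \<open>\<open>|M\<^sub>l|\<close> for an \<open>r \<times> s\<close> array; \<open>|M\<^sup>i\<^sub>l|\<close> for an array with \<open>s\<close> columns; \<open>|\<^sup>jM\<^sub>l|\<close> for an array with \<open>r\<close> rows.\<close>

definition occ :: "nat \<Rightarrow> nat \<Rightarrow> mset_array \<Rightarrow> nat \<Rightarrow> nat" where
  "occ r s M l = (\<Sum>i\<in>{1..r}. \<Sum>j\<in>{1..s}. count (M i j) l)"

definition row_occ :: "nat \<Rightarrow> mset_array \<Rightarrow> nat \<Rightarrow> nat \<Rightarrow> nat" where
  "row_occ s M i l = (\<Sum>j\<in>{1..s}. count (M i j) l)"

definition col_occ :: "nat \<Rightarrow> mset_array \<Rightarrow> nat \<Rightarrow> nat \<Rightarrow> nat" where
  "col_occ r M j l = (\<Sum>i\<in>{1..r}. count (M i j) l)"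

definition latin_square :: "nat \<Rightarrow> nat \<Rightarrow> (nat \<Rightarrow> nat) \<Rightarrow> nat \<Rightarrow> mset_array \<Rightarrow> bool" where
  "latin_square n k \<rho> lam N \<longleftrightarrow>
     lambda_matrix n n k lam N \<and>
     (\<forall>l\<in>{1..k}. occ n n N l = \<rho> l) \<and>
     (\<forall>l\<in>{1..k}. \<forall>i\<in>{1..n}. row_occ n N i l \<le> lam) \<and>
     (\<forall>l\<in>{1..k}. \<forall>j\<in>{1..n}. col_occ n N j l \<le> lam)"

definition latin_rectangle :: "nat \<Rightarrow> nat \<Rightarrow> nat \<Rightarrow> (nat \<Rightarrow> nat) \<Rightarrow> nat \<Rightarrow> mset_array \<Rightarrow> bool" where
  "latin_rectangle r n k \<rho> lam M \<longleftrightarrow>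
     lambda_matrix r n k lam M \<and>
     (\<forall>l\<in>{1..k}. occ r n M l \<le> \<rho> l) \<and>
     (\<forall>l\<in>{1..k}. \<forall>i\<in>{1..r}. row_occ n M i l \<le> lam) \<and>
     (\<forall>l\<in>{1..k}. \<forall>j\<in>{1..n}. col_occ r M j l \<le> lam)"

definition simple_array :: "nat \<Rightarrow> nat \<Rightarrow> nat \<Rightarrow> mset_array \<Rightarrow> bool" where
  "simple_array r s k M \<longleftrightarrow>
     (\<forall>i\<in>{1..r}. \<forall>j\<in>{1..s}. \<forall>l\<in>{1..k}. count (M i j) l \<le> 1)"

definition extended_to :: "nat \<Rightarrow> nat \<Rightarrow> mset_array \<Rightarrow> mset_array \<Rightarrow> bool" where
  "extended_to r n M N \<longleftrightarrow> (\<forall>i\<in>{1..r}. \<forall>j\<in>{1..n}. N i j = M i j)"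

text \<open>
  Subtraction on \<^typ>\<open>nat\<close> is truncated, so it is literally the operation \<open>max {0, x - y}\<close>.  For an
  \<open>r \<times> n\<close> Latin rectangle with \<open>r \<le> n\<close>, the differences \<open>n - r\<close>, \<open>\<rho>\<^sub>l - |M\<^sub>l|\<close> and
  \<open>\<lambda> - |\<^sup>jM\<^sub>l|\<close> are never negative, so for them it agrees with integer subtraction.
\<close>

end

theory Submission
  imports Defs
begin

text \<open>
  Put \<open>m = n - r\<close>, \<open>e l = \<rho> l - occ r n M l\<close> and \<open>u j l = min m (lam - col_occ r M j l)\<close>.  All that
  matters about the missing \<open>m\<close> rows, as far as columns and totals are concerned, is the number
  \<open>b j l\<close> of times that the symbol \<open>l\<close> is added to column \<open>j\<close>.  In an extension these numbers
  satisfy \<open>b j l \<le> u j l\<close>, they sum to \<open>lam * m\<close> over the symbols and to \<open>e l\<close> over the columns, and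
  \<open>e l \<le> lam * m\<close>.  The listed conditions follow by comparing sums, except that \<open>lam \<le> k\<close> says that a
  cell can hold \<open>lam\<close> distinct symbols.

  Conversely, the last condition is the cut condition for the transportation problem that asks for
  such a matrix \<open>b\<close>, and it is sufficient (\<open>transportation\<close>).  The proof lowers the capacities as
  long as no cut becomes too small; when no capacity can be lowered, uncrossing tight cuts shows
  that the capacities themselves form a solution.

  It remains to distribute \<open>b\<close> over the \<open>m\<close> new rows so that a row receives each symbol at most
  once in each cell, exactly \<open>lam\<close> symbols in each cell, and each symbol at most \<open>lam\<close> times
  altogether.  The fractional matrix \<open>b / m\<close> meets these demands for a single row, so by the
  integrality of transportation problems there is an integral one, and its choice can be made to
  leave a matrix with the same properties for the other \<open>m - 1\<close> rows (\<open>balanced_decomposition\<close>; this is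
  an edge colouring of a bipartite multigraph that is balanced in the sense of de Werra).  To
  have equations only, an auxiliary column \<open>0\<close> collects what a symbol lacks to appear \<open>lam\<close> times in
  each new row.
\<close>

section \<open>Integral transportation problems\<close>

definition cut_condition ::
    "'a set \<Rightarrow> 'b set \<Rightarrow> ('a \<Rightarrow> nat) \<Rightarrow> ('b \<Rightarrow> nat) \<Rightarrow> ('a \<Rightarrow> 'b \<Rightarrow> nat) \<Rightarrow> bool" where
  "cut_condition X Y s t u \<longleftrightarrow>
     (\<forall>J\<subseteq>X. \<forall>K\<subseteq>Y. sum s J \<le> (\<Sum>x\<in>J. \<Sum>y\<in>K. u x y) + sum t (Y - K))"

definition tight_cut ::
    "'b set \<Rightarrow> ('a \<Rightarrow> nat) \<Rightarrow> ('b \<Rightarrow> nat) \<Rightarrow> ('a \<Rightarrow> 'b \<Rightarrow> nat) \<Rightarrow> 'a set \<Rightarrow> 'b set \<Rightarrow> bool" where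
  "tight_cut Y s t u J K \<longleftrightarrow> sum s J = (\<Sum>x\<in>J. \<Sum>y\<in>K. u x y) + sum t (Y - K)"

lemma rectangle_sum_indicator:
  fixes u :: "'a \<Rightarrow> 'b \<Rightarrow> nat"
  assumes "finite X" "finite Y" "J \<subseteq> X" "K \<subseteq> Y"
  shows "(\<Sum>x\<in>J. \<Sum>y\<in>K. u x y) = (\<Sum>x\<in>X. \<Sum>y\<in>Y. if x \<in> J \<and> y \<in> K then u x y else 0)"
proof -
  have "(\<Sum>x\<in>X. \<Sum>y\<in>Y. if x \<in> J \<and> y \<in> K then u x y else 0)
      = (\<Sum>x\<in>X. if x \<in> J then \<Sum>y\<in>Y. if y \<in> K then u x y else 0 else 0)"
    by (intro sum.cong) auto
  also have "\<dots> = (\<Sum>x\<in>X \<inter> J. \<Sum>y\<in>Y \<inter> K. u x y)"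
    using assms by (simp add: sum.inter_restrict)
  finally show ?thesis
    using assms by (simp add: Int_absorb1)
qed

lemma rectangle_sum_decrement:
  fixes u :: "'a \<Rightarrow> 'b \<Rightarrow> nat"
  assumes fin: "finite J" "finite K" and mem: "x \<in> J" "y \<in> K" and pos: "0 < u x y"
  shows "(\<Sum>x'\<in>J. \<Sum>y'\<in>K. u x' y') = (\<Sum>x'\<in>J. \<Sum>y'\<in>K. (u(x := (u x)(y := u x y - 1))) x' y') + 1"
proof -
  let ?u = "u(x := (u x)(y := u x y - 1))"
  have "(\<Sum>y'\<in>K - {y}. ?u x y') = (\<Sum>y'\<in>K - {y}. u x y')"
    by (intro sum.cong) auto
  then have "(\<Sum>y'\<in>K. u x y') = (\<Sum>y'\<in>K. ?u x y') + 1"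
    using pos sum.remove[OF fin(2) mem(2), of "u x"] sum.remove[OF fin(2) mem(2), of "?u x"] by simp
  moreover have "(\<Sum>x'\<in>J - {x}. \<Sum>y'\<in>K. ?u x' y') = (\<Sum>x'\<in>J - {x}. \<Sum>y'\<in>K. u x' y')"
    by (intro sum.cong) auto
  ultimately show ?thesis
    using sum.remove[OF fin(1) mem(1), of "\<lambda>x'. \<Sum>y'\<in>K. u x' y'"]
      sum.remove[OF fin(1) mem(1), of "\<lambda>x'. \<Sum>y'\<in>K. ?u x' y'"] by linarith
qed

text \<open>
  The set \<open>J \<union> (Y - K)\<close> is the source side of a cut, and cut functions are submodular.
\<close>

lemma rectangle_sum_submodular:
  fixes u :: "'a \<Rightarrow> 'b \<Rightarrow> nat"
  assumes "finite X" "finite Y" "J \<subseteq> X" "K \<subseteq> Y" "J' \<subseteq> X" "K' \<subseteq> Y"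
  shows "(\<Sum>x\<in>J \<inter> J'. \<Sum>y\<in>K \<union> K'. u x y) + (\<Sum>x\<in>J \<union> J'. \<Sum>y\<in>K \<inter> K'. u x y)
       \<le> (\<Sum>x\<in>J. \<Sum>y\<in>K. u x y) + (\<Sum>x\<in>J'. \<Sum>y\<in>K'. u x y)"
proof -
  have *: "J \<inter> J' \<subseteq> X" "J \<union> J' \<subseteq> X" "K \<inter> K' \<subseteq> Y" "K \<union> K' \<subseteq> Y"
    using assms by auto
  show ?thesis
    unfolding rectangle_sum_indicator[OF assms(1,2) *(1) *(4)]
      rectangle_sum_indicator[OF assms(1,2) *(2) *(3)]
      rectangle_sum_indicator[OF assms(1,2) assms(3,4)]
      rectangle_sum_indicator[OF assms(1,2) assms(5,6)]
      sum.distrib[symmetric]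
    by (intro sum_mono) auto
qed

lemma tight_cut_uncross:
  assumes fin: "finite X" "finite Y" and cut: "cut_condition X Y s t u"
    and sub: "J \<subseteq> X" "K \<subseteq> Y" "J' \<subseteq> X" "K' \<subseteq> Y"
    and tight: "tight_cut Y s t u J K" "tight_cut Y s t u J' K'"
  shows "tight_cut Y s t u (J \<inter> J') (K \<union> K')"
proof -
  have finJ: "finite J" "finite J'"
    using fin sub finite_subset by blast+
  have s: "sum s (J \<union> J') + sum s (J \<inter> J') = sum s J + sum s J'"
    using finJ by (rule sum.union_inter)
  have "sum t ((Y - K) \<union> (Y - K')) + sum t ((Y - K) \<inter> (Y - K')) = sum t (Y - K) + sum t (Y - K')"
    using fin by (intro sum.union_inter) auto
  then have t: "sum t (Y - K \<inter> K') + sum t (Y - (K \<union> K')) = sum t (Y - K) + sum t (Y - K')"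
    by (simp add: Diff_Int Diff_Un)
  have "J \<inter> J' \<subseteq> X" "K \<union> K' \<subseteq> Y" "J \<union> J' \<subseteq> X" "K \<inter> K' \<subseteq> Y"
    using sub by auto
  then have
    "sum s (J \<inter> J') \<le> (\<Sum>x\<in>J \<inter> J'. \<Sum>y\<in>K \<union> K'. u x y) + sum t (Y - (K \<union> K'))"
    "sum s (J \<union> J') \<le> (\<Sum>x\<in>J \<union> J'. \<Sum>y\<in>K \<inter> K'. u x y) + sum t (Y - K \<inter> K')"
    using cut unfolding cut_condition_def by blast+
  then show ?thesis
    using s t rectangle_sum_submodular[OF fin sub, of u] tight
    unfolding tight_cut_def by linarith
qed

text \<open>
  A positive capacity that cannot be lowered is crossed by a tight cut.  Uncrossing these cuts over
  all positive entries of a row gives one tight cut that contains the whole row, and comparison with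
  the same cut without the row bounds the row sum.
\<close>

lemma irreducible_capacity_row_sum:
  assumes fin: "finite X" "finite Y" and cut: "cut_condition X Y s t u"
    and total: "sum s X = sum t Y"
    and irreducible:
      "\<And>x y. x \<in> X \<Longrightarrow> y \<in> Y \<Longrightarrow> 0 < u x y \<Longrightarrow> \<not> cut_condition X Y s t (u(x := (u x)(y := u x y - 1)))"
    and x: "x \<in> X"
  shows "(\<Sum>y\<in>Y. u x y) = s x"
proof (rule antisym)
  have crossing: "\<exists>J\<subseteq>X. \<exists>K\<subseteq>Y. x \<in> J \<and> y \<in> K \<and> tight_cut Y s t u J K"
    if y: "y \<in> Y" "0 < u x y" for y
  proof -
    let ?u = "u(x := (u x)(y := u x y - 1))"
    obtain J K where JK: "J \<subseteq> X" "K \<subseteq> Y"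
      and violated: "\<not> sum s J \<le> (\<Sum>x\<in>J. \<Sum>y\<in>K. ?u x y) + sum t (Y - K)"
      using irreducible[OF x y] unfolding cut_condition_def by blast
    have le: "sum s J \<le> (\<Sum>x\<in>J. \<Sum>y\<in>K. u x y) + sum t (Y - K)"
      using cut JK unfolding cut_condition_def by blast
    have finJK: "finite J" "finite K"
      using JK fin finite_subset by blast+
    have mem: "x \<in> J \<and> y \<in> K"
    proof (rule ccontr)
      assume "\<not> (x \<in> J \<and> y \<in> K)"
      then have "(\<Sum>x\<in>J. \<Sum>y\<in>K. ?u x y) = (\<Sum>x\<in>J. \<Sum>y\<in>K. u x y)"
        by (intro sum.cong) auto
      then show False
        using violated le by simp
    qed
    have "(\<Sum>x\<in>J. \<Sum>y\<in>K. u x y) = (\<Sum>x\<in>J. \<Sum>y\<in>K. ?u x y) + 1"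
      using rectangle_sum_decrement[OF finJK] mem y(2) by blast
    then have "tight_cut Y s t u J K"
      unfolding tight_cut_def using le violated by linarith
    then show ?thesis
      using JK mem by blast
  qed
  define P where "P = {y \<in> Y. 0 < u x y}"
  have "finite P"
    unfolding P_def using fin by simp
  then have "P \<subseteq> {y \<in> Y. 0 < u x y} \<longrightarrow> (\<exists>J\<subseteq>X. \<exists>K\<subseteq>Y. x \<in> J \<and> P \<subseteq> K \<and> tight_cut Y s t u J K)"
  proof (induction P)
    case empty
    \<comment> \<open>Equality of the totals says that the cut around everything is tight.\<close>
    have "tight_cut Y s t u X {}"
      unfolding tight_cut_def using total by simp
    then show ?case
      using x by blast
  next
    case (insert y P)
    show ?case
    proof
      assume P: "insert y P \<subseteq> {y \<in> Y. 0 < u x y}"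
      then obtain J K where JK: "J \<subseteq> X" "K \<subseteq> Y" "x \<in> J" "P \<subseteq> K" "tight_cut Y s t u J K"
        using insert.IH by auto
      obtain J' K' where JK': "J' \<subseteq> X" "K' \<subseteq> Y" "x \<in> J'" "y \<in> K'" "tight_cut Y s t u J' K'"
        using crossing[of y] P by auto
      have "tight_cut Y s t u (J \<inter> J') (K \<union> K')"
        using tight_cut_uncross[OF fin cut JK(1,2) JK'(1,2) JK(5) JK'(5)] .
      moreover have "J \<inter> J' \<subseteq> X" "K \<union> K' \<subseteq> Y" "x \<in> J \<inter> J'" "insert y P \<subseteq> K \<union> K'"
        using JK JK' by auto
      ultimately show "\<exists>J\<subseteq>X. \<exists>K\<subseteq>Y. x \<in> J \<and> insert y P \<subseteq> K \<and> tight_cut Y s t u J K"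
        by blast
    qed
  qed
  then obtain J K where JK: "J \<subseteq> X" "K \<subseteq> Y" "x \<in> J" "P \<subseteq> K" "tight_cut Y s t u J K"
    unfolding P_def by auto
  have finJ: "finite J"
    using JK fin finite_subset by blast
  have "sum s (J - {x}) \<le> (\<Sum>x\<in>J - {x}. \<Sum>y\<in>K. u x y) + sum t (Y - K)"
    using cut JK unfolding cut_condition_def by blast
  then have "(\<Sum>y\<in>K. u x y) \<le> s x"
    using JK(5) finJ JK(3) unfolding tight_cut_def by (simp add: sum.remove[where x = x and A = J])
  moreover have "(\<Sum>y\<in>Y. u x y) = (\<Sum>y\<in>K. u x y)"
    using JK(2,4) fin unfolding P_def by (intro sum.mono_neutral_right) auto
  ultimately show "(\<Sum>y\<in>Y. u x y) \<le> s x"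
    by simp
next
  have "sum s {x} \<le> (\<Sum>x\<in>{x}. \<Sum>y\<in>Y. u x y) + sum t (Y - Y)"
    using cut x unfolding cut_condition_def by blast
  then show "s x \<le> (\<Sum>y\<in>Y. u x y)"
    by simp
qed

theorem transportation:
  fixes s :: "'a \<Rightarrow> nat" and t :: "'b \<Rightarrow> nat" and u :: "'a \<Rightarrow> 'b \<Rightarrow> nat"
  assumes fin: "finite X" "finite Y" and total: "sum s X = sum t Y"
    and cut: "cut_condition X Y s t u"
  obtains b where "\<And>x y. b x y \<le> u x y"
    and "\<And>x. x \<in> X \<Longrightarrow> (\<Sum>y\<in>Y. b x y) = s x"
    and "\<And>y. y \<in> Y \<Longrightarrow> (\<Sum>x\<in>X. b x y) = t y"
proof -
  define good where "good b \<longleftrightarrow> (\<forall>x y. b x y \<le> u x y) \<and> cut_condition X Y s t b" for b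
  have "good u"
    using cut unfolding good_def by simp
  then obtain b where b: "good b"
    and least: "\<And>b'. good b' \<Longrightarrow> (\<Sum>x\<in>X. \<Sum>y\<in>Y. b x y) \<le> (\<Sum>x\<in>X. \<Sum>y\<in>Y. b' x y)"
    using ex_has_least_nat[of good u "\<lambda>b. \<Sum>x\<in>X. \<Sum>y\<in>Y. b x y"] by blast
  have b_le: "\<And>x y. b x y \<le> u x y" and b_cut: "cut_condition X Y s t b"
    using b unfolding good_def by auto
  have row: "(\<Sum>y\<in>Y. b x y) = s x" if "x \<in> X" for x
  proof (rule irreducible_capacity_row_sum[OF fin b_cut total _ that])
    fix x y
    assume xy: "x \<in> X" "y \<in> Y" "0 < b x y"
    let ?b = "b(x := (b x)(y := b x y - 1))"
    have "(\<Sum>x\<in>X. \<Sum>y\<in>Y. b x y) = (\<Sum>x\<in>X. \<Sum>y\<in>Y. ?b x y) + 1"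
      using rectangle_sum_decrement[of X Y x y b, OF fin xy] .
    then have "\<not> good ?b"
      using least[of ?b] by linarith
    moreover have "?b x' y' \<le> u x' y'" for x' y'
      using b_le[of x' y'] by auto
    ultimately show "\<not> cut_condition X Y s t ?b"
      unfolding good_def by blast
  qed
  \<comment> \<open>The cuts \<open>(X, {y})\<close> bound the column sums from below; equal totals leave no room.\<close>
  have col_ge: "t y \<le> (\<Sum>x\<in>X. b x y)" if y: "y \<in> Y" for y
  proof -
    have "sum s X \<le> (\<Sum>x\<in>X. \<Sum>y\<in>{y}. b x y) + sum t (Y - {y})"
      using b_cut y unfolding cut_condition_def by blast
    then show ?thesis
      using total y fin by (simp add: sum.remove[where x = y])
  qed
  have "(\<Sum>y\<in>Y. \<Sum>x\<in>X. b x y) = (\<Sum>y\<in>Y. t y)"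
    using row total by (subst sum.swap) simp
  then have "(\<Sum>x\<in>X. b x y) = t y" if "y \<in> Y" for y
    using sum_mono_inv[of t Y "\<lambda>y. \<Sum>x\<in>X. b x y" y] col_ge that fin by simp
  then show ?thesis
    using that b_le row by blast
qed

section \<open>Balanced decomposition of an integral matrix\<close>

text \<open>
  The matrix \<open>b / m\<close> has the required row and column sums, so its fractional part shows that the
  cut condition holds for the problem of choosing which entries of \<open>b / m\<close> to round up.
\<close>

lemma integral_share:
  fixes b :: "'a \<Rightarrow> 'b \<Rightarrow> nat"
  assumes fin: "finite X" "finite Y" and m: "0 < m"
    and row: "\<And>x. x \<in> X \<Longrightarrow> (\<Sum>y\<in>Y. b x y) = m * s x"
    and col: "\<And>y. y \<in> Y \<Longrightarrow> (\<Sum>x\<in>X. b x y) = m * t y"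
  obtains a where "\<And>x y. b x y div m \<le> a x y"
    and "\<And>x y. a x y \<le> b x y div m + (if b x y mod m = 0 then 0 else 1)"
    and "\<And>x. x \<in> X \<Longrightarrow> (\<Sum>y\<in>Y. a x y) = s x"
    and "\<And>y. y \<in> Y \<Longrightarrow> (\<Sum>x\<in>X. a x y) = t y"
proof -
  define q where "q x y = b x y div m" for x y
  define f where "f x y = b x y mod m" for x y
  define u where "u x y = (if b x y mod m = 0 then 0 else 1 :: nat)" for x y
  have b_eq: "b x y = m * q x y + f x y" for x y
    unfolding q_def f_def by simp
  have f_le: "f x y \<le> m * u x y" for x y
    unfolding f_def u_def using m by (simp add: less_imp_le)
  define s' where "s' x = s x - (\<Sum>y\<in>Y. q x y)" for x
  define t' where "t' y = t y - (\<Sum>x\<in>X. q x y)" for y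
  have row_q: "(\<Sum>y\<in>Y. q x y) \<le> s x" and row_f: "(\<Sum>y\<in>Y. f x y) = m * s' x" if "x \<in> X" for x
  proof -
    have eq: "m * (\<Sum>y\<in>Y. q x y) + (\<Sum>y\<in>Y. f x y) = m * s x"
      using row[OF that] by (simp add: b_eq sum.distrib sum_distrib_left)
    then have "m * (\<Sum>y\<in>Y. q x y) \<le> m * s x"
      by linarith
    then show "(\<Sum>y\<in>Y. q x y) \<le> s x"
      using m by simp
    show "(\<Sum>y\<in>Y. f x y) = m * s' x"
      unfolding s'_def diff_mult_distrib2 using eq by linarith
  qed
  have col_q: "(\<Sum>x\<in>X. q x y) \<le> t y" and col_f: "(\<Sum>x\<in>X. f x y) = m * t' y" if "y \<in> Y" for y
  proof -
    have eq: "m * (\<Sum>x\<in>X. q x y) + (\<Sum>x\<in>X. f x y) = m * t y"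
      using col[OF that] by (simp add: b_eq sum.distrib sum_distrib_left)
    then have "m * (\<Sum>x\<in>X. q x y) \<le> m * t y"
      by linarith
    then show "(\<Sum>x\<in>X. q x y) \<le> t y"
      using m by simp
    show "(\<Sum>x\<in>X. f x y) = m * t' y"
      unfolding t'_def diff_mult_distrib2 using eq by linarith
  qed
  have "m * sum s' X = (\<Sum>x\<in>X. \<Sum>y\<in>Y. f x y)"
    by (simp add: row_f sum_distrib_left)
  also have "\<dots> = (\<Sum>y\<in>Y. \<Sum>x\<in>X. f x y)"
    by (rule sum.swap)
  also have "\<dots> = m * sum t' Y"
    by (simp add: col_f sum_distrib_left)
  finally have total: "sum s' X = sum t' Y"
    using m by simp
  have cut: "cut_condition X Y s' t' u"
    unfolding cut_condition_def
  proof (intro allI impI)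
    fix J K
    assume JK: "J \<subseteq> X" "K \<subseteq> Y"
    have "m * sum s' J = (\<Sum>x\<in>J. \<Sum>y\<in>Y. f x y)"
      using JK by (simp add: row_f sum_distrib_left subset_iff)
    also have "\<dots> = (\<Sum>x\<in>J. (\<Sum>y\<in>K. f x y) + (\<Sum>y\<in>Y - K. f x y))"
      using JK fin by (intro sum.cong refl) (simp add: sum.subset_diff[of K Y])
    also have "\<dots> = (\<Sum>x\<in>J. \<Sum>y\<in>K. f x y) + (\<Sum>x\<in>J. \<Sum>y\<in>Y - K. f x y)"
      by (rule sum.distrib)
    also have "\<dots> \<le> (\<Sum>x\<in>J. \<Sum>y\<in>K. m * u x y) + (\<Sum>x\<in>X. \<Sum>y\<in>Y - K. f x y)"
      using JK fin by (intro add_mono sum_mono f_le sum_mono2) auto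
    also have "(\<Sum>x\<in>X. \<Sum>y\<in>Y - K. f x y) = (\<Sum>y\<in>Y - K. \<Sum>x\<in>X. f x y)"
      by (rule sum.swap)
    also have "\<dots> = (\<Sum>y\<in>Y - K. m * t' y)"
      by (simp add: col_f)
    finally have "m * sum s' J \<le> m * ((\<Sum>x\<in>J. \<Sum>y\<in>K. u x y) + sum t' (Y - K))"
      by (simp add: sum_distrib_left distrib_left)
    then show "sum s' J \<le> (\<Sum>x\<in>J. \<Sum>y\<in>K. u x y) + sum t' (Y - K)"
      using m by simp
  qed
  obtain a where a: "\<And>x y. a x y \<le> u x y"
    "\<And>x. x \<in> X \<Longrightarrow> (\<Sum>y\<in>Y. a x y) = s' x" "\<And>y. y \<in> Y \<Longrightarrow> (\<Sum>x\<in>X. a x y) = t' y"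
    using transportation[OF fin total cut] by blast
  show ?thesis
  proof (rule that[of "\<lambda>x y. q x y + a x y"])
    show "b x y div m \<le> q x y + a x y" for x y
      unfolding q_def by simp
    show "q x y + a x y \<le> b x y div m + (if b x y mod m = 0 then 0 else 1)" for x y
      using a(1)[of x y] unfolding q_def u_def by simp
    show "(\<Sum>y\<in>Y. q x y + a x y) = s x" if "x \<in> X" for x
      using a(2)[OF that] row_q[OF that] unfolding s'_def by (simp add: sum.distrib)
    show "(\<Sum>x\<in>X. q x y + a x y) = t y" if "y \<in> Y" for y
      using a(3)[OF that] col_q[OF that] unfolding t'_def by (simp add: sum.distrib)
  qed
qed

text \<open>
  Splitting off one share after the other.  A share that rounds \<open>b / m\<close> respects the capacity \<open>c\<close> and
  leaves at most \<open>(m - 1) * c\<close> for the others.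
\<close>

theorem balanced_decomposition:
  fixes b c :: "'a \<Rightarrow> 'b \<Rightarrow> nat"
  assumes fin: "finite X" "finite Y" and "finite I"
    and "\<And>x. x \<in> X \<Longrightarrow> (\<Sum>y\<in>Y. b x y) = card I * s x"
    and "\<And>y. y \<in> Y \<Longrightarrow> (\<Sum>x\<in>X. b x y) = card I * t y"
    and "\<And>x y. x \<in> X \<Longrightarrow> y \<in> Y \<Longrightarrow> b x y \<le> card I * c x y"
  shows "\<exists>A. (\<forall>x\<in>X. \<forall>y\<in>Y. (\<Sum>i\<in>I. A i x y) = b x y) \<and>
    (\<forall>i\<in>I. \<forall>x\<in>X. \<forall>y\<in>Y. A i x y \<le> c x y) \<and>
    (\<forall>i\<in>I. \<forall>x\<in>X. (\<Sum>y\<in>Y. A i x y) = s x) \<and>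
    (\<forall>i\<in>I. \<forall>y\<in>Y. (\<Sum>x\<in>X. A i x y) = t y)"
  using assms(3-)
proof (induction I arbitrary: b)
  case empty
  then show ?case
    by auto
next
  case (insert i I)
  define m where "m = card (insert i I)"
  have m: "m = Suc (card I)"
    unfolding m_def using insert.hyps by simp
  then have m0: "0 < m"
    by simp
  note prems = insert.prems[folded m_def]
  obtain a where a: "\<And>x y. b x y div m \<le> a x y"
    "\<And>x y. a x y \<le> b x y div m + (if b x y mod m = 0 then 0 else 1)"
    "\<And>x. x \<in> X \<Longrightarrow> (\<Sum>y\<in>Y. a x y) = s x" "\<And>y. y \<in> Y \<Longrightarrow> (\<Sum>x\<in>X. a x y) = t y"
    using integral_share[where b = b, OF fin m0 prems(1,2)] by blast
  have a_le_b: "a x y \<le> b x y" for x y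
  proof -
    have "b x y div m + (if b x y mod m = 0 then 0 else 1) \<le> m * (b x y div m) + b x y mod m"
      using m0 by (intro add_mono) auto
    then show ?thesis
      using a(2)[of x y] by simp
  qed
  have bounds: "a x y \<le> c x y \<and> b x y - a x y \<le> card I * c x y" if xy: "x \<in> X" "y \<in> Y" for x y
  proof (cases "b x y mod m = 0")
    case True
    then obtain d where d: "b x y = m * d"
      by auto
    then have "a x y = d"
      using a(1,2)[of x y] m0 by simp
    moreover have "d \<le> c x y"
      using prems(3)[OF xy] d m0 by simp
    ultimately show ?thesis
      using d m by simp
  next
    case False
    let ?d = "b x y div m"
    have b_eq: "b x y = m * ?d + b x y mod m"
      by simp
    have "m * ?d < m * c x y"
      using prems(3)[OF xy] b_eq False by linarith
    then have d: "Suc ?d \<le> c x y"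
      by simp
    have "b x y mod m < m"
      using m0 by simp
    moreover have "m * ?d = ?d + card I * ?d"
      unfolding m by simp
    ultimately have "b x y \<le> a x y + card I * Suc ?d"
      using a(1)[of x y] b_eq unfolding m mult_Suc_right by linarith
    then have "b x y - a x y \<le> card I * Suc ?d"
      by simp
    also have "\<dots> \<le> card I * c x y"
      using d by (rule mult_le_mono2)
    finally show ?thesis
      using d a(2)[of x y] False by simp
  qed
  have "\<exists>A. (\<forall>x\<in>X. \<forall>y\<in>Y. (\<Sum>i\<in>I. A i x y) = b x y - a x y) \<and>
    (\<forall>i\<in>I. \<forall>x\<in>X. \<forall>y\<in>Y. A i x y \<le> c x y) \<and>
    (\<forall>i\<in>I. \<forall>x\<in>X. (\<Sum>y\<in>Y. A i x y) = s x) \<and>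
    (\<forall>i\<in>I. \<forall>y\<in>Y. (\<Sum>x\<in>X. A i x y) = t y)"
  proof (rule insert.IH)
    show "(\<Sum>y\<in>Y. b x y - a x y) = card I * s x" if "x \<in> X" for x
      using prems(1)[OF that] a(3)[OF that] m by (simp add: sum_subtractf_nat a_le_b)
    show "(\<Sum>x\<in>X. b x y - a x y) = card I * t y" if "y \<in> Y" for y
      using prems(2)[OF that] a(4)[OF that] m by (simp add: sum_subtractf_nat a_le_b)
    show "b x y - a x y \<le> card I * c x y" if "x \<in> X" "y \<in> Y" for x y
      using bounds[OF that] by simp
  qed
  then obtain A where A: "\<forall>x\<in>X. \<forall>y\<in>Y. (\<Sum>i\<in>I. A i x y) = b x y - a x y"
    "\<forall>i\<in>I. \<forall>x\<in>X. \<forall>y\<in>Y. A i x y \<le> c x y" "\<forall>i\<in>I. \<forall>x\<in>X. (\<Sum>y\<in>Y. A i x y) = s x"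
    "\<forall>i\<in>I. \<forall>y\<in>Y. (\<Sum>x\<in>X. A i x y) = t y"
    by blast
  have "(\<Sum>j\<in>insert i I. (A(i := a)) j x y) = b x y" if "x \<in> X" "y \<in> Y" for x y
  proof -
    have "(\<Sum>j\<in>I. (A(i := a)) j x y) = (\<Sum>j\<in>I. A j x y)"
      using insert.hyps by (intro sum.cong) auto
    then show ?thesis
      using A(1) that a_le_b[of x y] insert.hyps by simp
  qed
  then show ?case
    using A(2-4) a(3,4) bounds by (intro exI[of _ "A(i := a)"]) auto
qed

section \<open>Latin rectangles\<close>

lemma sum_count_eq_size:
  assumes "finite S" "set_mset A \<subseteq> S"
  shows "(\<Sum>l\<in>S. count A l) = size A"
  unfolding size_multiset_overloaded_eq using assms
  by (intro sum.mono_neutral_right) (auto simp: count_eq_zero_iff)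

lemma sum_rows_split:
  assumes "r \<le> (n :: nat)"
  shows "(\<Sum>i\<in>{1..n}. f i) = (\<Sum>i\<in>{1..r}. f i) + (\<Sum>i\<in>{r+1..n}. f i)"
proof -
  have "{1..r} \<union> {r+1..n} = {1..n}"
    using assms by auto
  moreover have "sum f ({1..r} \<union> {r+1..n}) = sum f {1..r} + sum f {r+1..n}"
    by (rule sum.union_disjoint) auto
  ultimately show ?thesis
    by (simp only:)
qed

lemma sum_occ:
  assumes "lambda_matrix r s k lam M"
  shows "(\<Sum>l\<in>{1..k}. occ r s M l) = lam * s * r"
proof -
  have "(\<Sum>l\<in>{1..k}. occ r s M l) = (\<Sum>i\<in>{1..r}. \<Sum>l\<in>{1..k}. \<Sum>j\<in>{1..s}. count (M i j) l)"
    unfolding occ_def by (rule sum.swap)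
  also have "\<dots> = (\<Sum>i\<in>{1..r}. \<Sum>j\<in>{1..s}. \<Sum>l\<in>{1..k}. count (M i j) l)"
    by (intro sum.cong refl sum.swap)
  also have "\<dots> = (\<Sum>i\<in>{1..r}. \<Sum>j\<in>{1..s}. lam)"
    using assms unfolding lambda_matrix_def by (intro sum.cong refl) (simp add: sum_count_eq_size)
  finally show ?thesis
    by simp
qed

text \<open>
  The conditions on \<open>b\<close> that an extension imposes: \<open>b j l\<close> counts the copies of \<open>l\<close> in column \<open>j\<close> below
  the given rectangle.
\<close>

lemma extension_added_counts:
  assumes "r \<le> n"
    and N: "latin_square n k \<rho> lam N" "simple_array n n k N" "extended_to r n M N"
  obtains b where
    "\<And>j l. j \<in> {1..n} \<Longrightarrow> l \<in> {1..k} \<Longrightarrow> b j l \<le> min (n - r) (lam - col_occ r M j l)"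
    and "\<And>j. j \<in> {1..n} \<Longrightarrow> (\<Sum>l\<in>{1..k}. b j l) = lam * (n - r)"
    and "\<And>l. l \<in> {1..k} \<Longrightarrow> (\<Sum>j\<in>{1..n}. b j l) = \<rho> l - occ r n M l"
    and "\<And>l. l \<in> {1..k} \<Longrightarrow> \<rho> l - occ r n M l \<le> lam * (n - r)"
proof -
  define b where "b j l = (\<Sum>i\<in>{r+1..n}. count (N i j) l)" for j l
  have col: "col_occ n N j l = col_occ r M j l + b j l" if "j \<in> {1..n}" for j l
    unfolding col_occ_def b_def sum_rows_split[OF \<open>r \<le> n\<close>]
    using N(3) that unfolding extended_to_def by simp
  have occ: "\<rho> l - occ r n M l = (\<Sum>i\<in>{r+1..n}. \<Sum>j\<in>{1..n}. count (N i j) l)" if "l \<in> {1..k}" for l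
  proof -
    have "occ n n N l = occ r n M l + (\<Sum>i\<in>{r+1..n}. \<Sum>j\<in>{1..n}. count (N i j) l)"
    proof -
      have "occ r n N l = occ r n M l"
        unfolding occ_def using N(3) unfolding extended_to_def by (intro sum.cong refl) simp
      then show ?thesis
        unfolding occ_def
        using sum_rows_split[OF \<open>r \<le> n\<close>, of "\<lambda>i. \<Sum>j\<in>{1..n}. count (N i j) l"] by linarith
    qed
    then show ?thesis
      using N(1) that unfolding latin_square_def by simp
  qed
  show ?thesis
  proof (rule that[of b])
    fix j l
    assume jl: "j \<in> {1..n}" "l \<in> {1..k}"
    have "b j l \<le> (\<Sum>i\<in>{r+1..n}. 1)"
      unfolding b_def using N(2) jl unfolding simple_array_def by (intro sum_mono) simp
    moreover have "col_occ n N j l \<le> lam"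
      using N(1) jl unfolding latin_square_def by blast
    ultimately show "b j l \<le> min (n - r) (lam - col_occ r M j l)"
      using col[OF jl(1), of l] by simp
  next
    fix j
    assume j: "j \<in> {1..n}"
    have "(\<Sum>l\<in>{1..k}. b j l) = (\<Sum>i\<in>{r+1..n}. \<Sum>l\<in>{1..k}. count (N i j) l)"
      unfolding b_def by (rule sum.swap)
    also have "\<dots> = (\<Sum>i\<in>{r+1..n}. lam)"
      using N(1) j unfolding latin_square_def lambda_matrix_def
      by (intro sum.cong refl) (simp add: sum_count_eq_size)
    finally show "(\<Sum>l\<in>{1..k}. b j l) = lam * (n - r)"
      by simp
  next
    fix l
    assume l: "l \<in> {1..k}"
    show "(\<Sum>j\<in>{1..n}. b j l) = \<rho> l - occ r n M l"
      unfolding occ[OF l] b_def by (rule sum.swap)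
    have "\<rho> l - occ r n M l \<le> (\<Sum>i\<in>{r+1..n}. lam)"
      unfolding occ[OF l]
      using N(1) l unfolding latin_square_def row_occ_def by (intro sum_mono) simp
    then show "\<rho> l - occ r n M l \<le> lam * (n - r)"
      by (simp add: mult.commute)
  qed
qed

text \<open>
  Conversely such a \<open>b\<close> suffices: decomposing it into \<open>n - r\<close> balanced parts gives the new rows.
\<close>

lemma extension_from_added_counts:
  assumes le: "r \<le> n" "n \<le> k"
    and M: "latin_rectangle r n k \<rho> lam M" "simple_array r n k M"
    and b_le: "\<And>j l. j \<in> {1..n} \<Longrightarrow> l \<in> {1..k} \<Longrightarrow> b j l \<le> min (n - r) (lam - col_occ r M j l)"
    and b_row: "\<And>j. j \<in> {1..n} \<Longrightarrow> (\<Sum>l\<in>{1..k}. b j l) = lam * (n - r)"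
    and b_col: "\<And>l. l \<in> {1..k} \<Longrightarrow> (\<Sum>j\<in>{1..n}. b j l) = \<rho> l - occ r n M l"
    and defect: "\<And>l. l \<in> {1..k} \<Longrightarrow> \<rho> l - occ r n M l \<le> lam * (n - r)"
  shows "\<exists>N. latin_square n k \<rho> lam N \<and> simple_array n n k N \<and> extended_to r n M N"
proof -
  define m where "m = n - r"
  define I where "I = {r+1..n}"
  have I: "finite I" "card I = m"
    unfolding I_def m_def by auto
  define e where "e l = \<rho> l - occ r n M l" for l
  have e_le: "e l \<le> lam * m" if "l \<in> {1..k}" for l
    using defect[OF that] unfolding e_def m_def .
  \<comment> \<open>Column \<open>0\<close> tops every symbol up to exactly \<open>lam\<close> occurrences per new row.\<close>
  define b' where "b' j l = (if j = 0 then lam * m - e l else b j l)" for j l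
  define s where "s j = (if j = 0 then lam * (k - n) else lam)" for j :: nat
  define c where "c j l = (if j = 0 then lam else 1)" for j l :: nat
  have "(\<Sum>l\<in>{1..k}. e l) = (\<Sum>l\<in>{1..k}. \<Sum>j\<in>{1..n}. b j l)"
    unfolding e_def by (intro sum.cong refl b_col[symmetric])
  also have "\<dots> = (\<Sum>j\<in>{1..n}. \<Sum>l\<in>{1..k}. b j l)"
    by (rule sum.swap)
  also have "\<dots> = (\<Sum>j\<in>{1..n}. lam * m)"
    unfolding m_def by (intro sum.cong refl b_row)
  finally have total: "(\<Sum>l\<in>{1..k}. e l) = n * (lam * m)"
    by simp
  have zero: "{0..n} = insert 0 {1..n}"
    by auto
  have row': "(\<Sum>l\<in>{1..k}. b' j l) = card I * s j" if "j \<in> {0..n}" for j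
  proof (cases "j = 0")
    case True
    have "(\<Sum>l\<in>{1..k}. lam * m - e l) = k * (lam * m) - n * (lam * m)"
      using sum_subtractf_nat[of "{1..k}" e "\<lambda>_. lam * m"] e_le total by simp
    also have "\<dots> = m * (lam * (k - n))"
      by (simp add: diff_mult_distrib2 mult.commute mult.left_commute)
    finally show ?thesis
      using True I unfolding b'_def s_def by simp
  next
    case False
    then show ?thesis
      using b_row[of j] that I unfolding b'_def s_def m_def by simp
  qed
  have col': "(\<Sum>j\<in>{0..n}. b' j l) = card I * lam" if "l \<in> {1..k}" for l
  proof -
    have "(\<Sum>j\<in>{1..n}. b' j l) = (\<Sum>j\<in>{1..n}. b j l)"
      unfolding b'_def by (intro sum.cong) auto
    then have "(\<Sum>j\<in>{1..n}. b' j l) = e l"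
      using b_col[OF that] unfolding e_def by simp
    then show ?thesis
      unfolding zero using e_le[OF that] I by (simp add: b'_def mult.commute)
  qed
  have cap': "b' j l \<le> card I * c j l" if "j \<in> {0..n}" "l \<in> {1..k}" for j l
    using b_le[of j l] that I unfolding b'_def c_def m_def by (auto simp: mult.commute)
  obtain A where
    A_sum: "\<And>j l. j \<in> {0..n} \<Longrightarrow> l \<in> {1..k} \<Longrightarrow> (\<Sum>i\<in>I. A i j l) = b' j l" and
    A_cap: "\<And>i j l. i \<in> I \<Longrightarrow> j \<in> {0..n} \<Longrightarrow> l \<in> {1..k} \<Longrightarrow> A i j l \<le> c j l" and
    A_row: "\<And>i j. i \<in> I \<Longrightarrow> j \<in> {0..n} \<Longrightarrow> (\<Sum>l\<in>{1..k}. A i j l) = s j" and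
    A_col: "\<And>i l. i \<in> I \<Longrightarrow> l \<in> {1..k} \<Longrightarrow> (\<Sum>j\<in>{0..n}. A i j l) = lam"
    using balanced_decomposition[of "{0..n}" "{1..k}" I b' s "\<lambda>_. lam" c, OF _ _ I(1) row' col' cap']
    by (simp only: finite_atLeastAtMost) blast
  define N where "N i j = (if i \<in> I then mset_set {l \<in> {1..k}. A i j l = 1} else M i j)" for i j
  have N_old: "N i j = M i j" if "i \<in> {1..r}" for i j
    using that unfolding N_def I_def by simp
  have N_new: "count (N i j) l = A i j l" if "i \<in> I" "j \<in> {1..n}" "l \<in> {1..k}" for i j l
    using A_cap[of i j l] that unfolding N_def c_def by (auto simp: count_mset_set' le_Suc_eq)
  have sub_N: "set_mset (N i j) \<subseteq> {1..k}" if "i \<in> I" for i j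
    using that unfolding N_def by auto
  have size_N: "size (N i j) = lam" if "i \<in> I" "j \<in> {1..n}" for i j
  proof -
    have "size (N i j) = (\<Sum>l\<in>{1..k}. count (N i j) l)"
      using sub_N[OF that(1)] by (simp add: sum_count_eq_size)
    also have "\<dots> = (\<Sum>l\<in>{1..k}. A i j l)"
      using that by (intro sum.cong refl N_new)
    finally show ?thesis
      using A_row[of i j] that unfolding s_def by simp
  qed
  have cases: "i \<in> {1..r} \<or> i \<in> I" if "i \<in> {1..n}" for i
    using that unfolding I_def by auto
  have col_N: "col_occ n N j l = col_occ r M j l + b j l" if "j \<in> {1..n}" "l \<in> {1..k}" for j l
  proof -
    have "(\<Sum>i\<in>I. count (N i j) l) = (\<Sum>i\<in>I. A i j l)"
      using that by (intro sum.cong refl N_new)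
    also have "\<dots> = b j l"
      using A_sum[of j l] that unfolding b'_def by simp
    finally show ?thesis
      unfolding col_occ_def sum_rows_split[OF le(1)] I_def by (simp add: N_old)
  qed
  have row_N: "row_occ n N i l \<le> lam" if "i \<in> {1..n}" "l \<in> {1..k}" for i l
    using cases[OF that(1)]
  proof
    assume i: "i \<in> {1..r}"
    then show ?thesis
      using M(1) that(2) unfolding latin_rectangle_def row_occ_def by (simp add: N_old)
  next
    assume i: "i \<in> I"
    have "row_occ n N i l = (\<Sum>j\<in>{1..n}. A i j l)"
      unfolding row_occ_def using i that by (intro sum.cong refl N_new)
    also have "\<dots> \<le> (\<Sum>j\<in>{0..n}. A i j l)"
      by (intro sum_mono2) auto
    finally show ?thesis
      using A_col[OF i that(2)] by simp
  qed
  have occ_N: "occ n n N l = \<rho> l" if l: "l \<in> {1..k}" for l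
  proof -
    have "occ n n N l = (\<Sum>j\<in>{1..n}. col_occ n N j l)"
      unfolding occ_def col_occ_def by (rule sum.swap)
    also have "\<dots> = (\<Sum>j\<in>{1..n}. col_occ r M j l) + (\<Sum>j\<in>{1..n}. b j l)"
      using l by (simp add: col_N sum.distrib)
    also have "(\<Sum>j\<in>{1..n}. col_occ r M j l) = occ r n M l"
      unfolding occ_def col_occ_def by (rule sum.swap)
    finally show ?thesis
      using b_col[OF l] M(1) l unfolding latin_rectangle_def by simp
  qed
  have "lambda_matrix n n k lam N"
    unfolding lambda_matrix_def
  proof (intro ballI)
    fix i j
    assume ij: "i \<in> {1..n}" "j \<in> {1..n}"
    show "size (N i j) = lam \<and> set_mset (N i j) \<subseteq> {1..k}"
      using cases[OF ij(1)]
    proof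
      assume "i \<in> {1..r}"
      then show ?thesis
        using M(1) ij(2) unfolding latin_rectangle_def lambda_matrix_def by (simp add: N_old)
    next
      assume "i \<in> I"
      then show ?thesis
        using size_N sub_N ij(2) by blast
    qed
  qed
  moreover have "col_occ n N j l \<le> lam" if "j \<in> {1..n}" "l \<in> {1..k}" for j l
  proof -
    have "col_occ r M j l \<le> lam"
      using M(1) that unfolding latin_rectangle_def by blast
    then show ?thesis
      using col_N[OF that] b_le[OF that] by linarith
  qed
  ultimately have "latin_square n k \<rho> lam N"
    unfolding latin_square_def using occ_N row_N by blast
  moreover have "simple_array n n k N"
    unfolding simple_array_def
  proof (intro ballI)
    fix i j l
    assume ijl: "i \<in> {1..n}" "j \<in> {1..n}" "l \<in> {1..k}"
    show "count (N i j) l \<le> 1"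
      using cases[OF ijl(1)]
    proof
      assume "i \<in> {1..r}"
      then show ?thesis
        using M(2) ijl(2,3) unfolding simple_array_def by (simp add: N_old)
    next
      assume "i \<in> I"
      then show ?thesis
        using A_cap[of i j l] N_new ijl(2,3) unfolding c_def by simp
    qed
  qed
  moreover have "extended_to r n M N"
    unfolding extended_to_def by (simp add: N_old)
  ultimately show ?thesis
    by blast
qed

theorem corollary4p6:
  fixes r n k lam :: nat and \<rho> :: "nat \<Rightarrow> nat" and M :: mset_array
  assumes "0 < n" and "0 < k" and "0 < lam"
    and "r \<le> n" and "n \<le> k"
    and "\<forall>l\<in>{1..k}. 1 \<le> \<rho> l \<and> \<rho> l \<le> lam * n"
    and "(\<Sum>l\<in>{1..k}. \<rho> l) = lam * n ^ 2"
    and "latin_rectangle r n k \<rho> lam M"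
    and "simple_array r n k M"
  shows "(\<exists>N. latin_square n k \<rho> lam N \<and> simple_array n n k N \<and> extended_to r n M N) \<longleftrightarrow>
    lam \<le> k \<and>
    (\<forall>l\<in>{1..k}. \<rho> l - occ r n M l \<le> lam * (n - r)) \<and>
    (\<forall>j\<in>{1..n}. lam * (n - r) \<le> (\<Sum>l\<in>{1..k}. min (n - r) (lam - col_occ r M j l))) \<and>
    (\<forall>l\<in>{1..k}. \<rho> l - occ r n M l \<le> (\<Sum>j\<in>{1..n}. min (n - r) (lam - col_occ r M j l))) \<and>
    (\<forall>K. K \<subseteq> {1..k} \<longrightarrow>
       (\<Sum>j\<in>{1..n}. lam * (n - r) - (\<Sum>l\<in>K. min (n - r) (lam - col_occ r M j l)))
         \<le> (\<Sum>l\<in>{1..k} - K. \<rho> l - occ r n M l))"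
  (is "?extendable \<longleftrightarrow> ?rhs")
proof
  assume ?extendable
  then obtain N where N: "latin_square n k \<rho> lam N" "simple_array n n k N" "extended_to r n M N"
    by blast
  have one: "1 \<in> {1..n}"
    using \<open>0 < n\<close> by simp
  have size: "size (N 1 1) = lam" "set_mset (N 1 1) \<subseteq> {1..k}"
    using N(1) one unfolding latin_square_def lambda_matrix_def by blast+
  have "lam = (\<Sum>l\<in>{1..k}. count (N 1 1) l)"
    using size by (simp add: sum_count_eq_size)
  also have "\<dots> \<le> (\<Sum>l\<in>{1..k}. 1)"
    using N(2) one unfolding simple_array_def by (intro sum_mono) blast
  finally have lam_le: "lam \<le> k"
    by simp
  let ?u = "\<lambda>j l. min (n - r) (lam - col_occ r M j l)"
  obtain b where b: "\<And>j l. j \<in> {1..n} \<Longrightarrow> l \<in> {1..k} \<Longrightarrow> b j l \<le> ?u j l"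
    "\<And>j. j \<in> {1..n} \<Longrightarrow> (\<Sum>l\<in>{1..k}. b j l) = lam * (n - r)"
    "\<And>l. l \<in> {1..k} \<Longrightarrow> (\<Sum>j\<in>{1..n}. b j l) = \<rho> l - occ r n M l"
    "\<And>l. l \<in> {1..k} \<Longrightarrow> \<rho> l - occ r n M l \<le> lam * (n - r)"
    using extension_added_counts[OF \<open>r \<le> n\<close> N] by blast
  have cell: "lam * (n - r) \<le> (\<Sum>l\<in>{1..k}. ?u j l)" if "j \<in> {1..n}" for j
    unfolding b(2)[OF that, symmetric] using that by (intro sum_mono b(1))
  have symbol: "\<rho> l - occ r n M l \<le> (\<Sum>j\<in>{1..n}. ?u j l)" if "l \<in> {1..k}" for l
    unfolding b(3)[OF that, symmetric] using that by (intro sum_mono b(1))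
  have cut: "(\<Sum>j\<in>{1..n}. lam * (n - r) - (\<Sum>l\<in>K. ?u j l)) \<le> (\<Sum>l\<in>{1..k} - K. \<rho> l - occ r n M l)"
    if K: "K \<subseteq> {1..k}" for K
  proof -
    have "lam * (n - r) - (\<Sum>l\<in>K. ?u j l) \<le> (\<Sum>l\<in>{1..k} - K. b j l)" if j: "j \<in> {1..n}" for j
    proof -
      have "lam * (n - r) = (\<Sum>l\<in>{1..k} - K. b j l) + (\<Sum>l\<in>K. b j l)"
        using b(2)[OF j] sum.subset_diff[OF K, of "b j"] by simp
      moreover have "(\<Sum>l\<in>K. b j l) \<le> (\<Sum>l\<in>K. ?u j l)"
        using j K by (intro sum_mono b(1)) auto
      ultimately show ?thesis
        by linarith
    qed
    then have "(\<Sum>j\<in>{1..n}. lam * (n - r) - (\<Sum>l\<in>K. ?u j l))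
        \<le> (\<Sum>j\<in>{1..n}. \<Sum>l\<in>{1..k} - K. b j l)"
      by (rule sum_mono)
    also have "\<dots> = (\<Sum>l\<in>{1..k} - K. \<Sum>j\<in>{1..n}. b j l)"
      by (rule sum.swap)
    also have "\<dots> = (\<Sum>l\<in>{1..k} - K. \<rho> l - occ r n M l)"
      by (intro sum.cong refl b(3)) auto
    finally show ?thesis .
  qed
  show ?rhs
    by (intro conjI ballI allI impI lam_le b(4) cell symbol cut)
next
  let ?u = "\<lambda>j l. min (n - r) (lam - col_occ r M j l)"
  let ?e = "\<lambda>l. \<rho> l - occ r n M l"
  assume rhs: ?rhs
  then have defect: "\<And>l. l \<in> {1..k} \<Longrightarrow> ?e l \<le> lam * (n - r)"
    and cuts: "\<And>K. K \<subseteq> {1..k} \<Longrightarrow>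
      (\<Sum>j\<in>{1..n}. lam * (n - r) - (\<Sum>l\<in>K. ?u j l)) \<le> (\<Sum>l\<in>{1..k} - K. ?e l)"
    by blast+
  have M: "lambda_matrix r n k lam M" "\<And>l. l \<in> {1..k} \<Longrightarrow> occ r n M l \<le> \<rho> l"
    using assms(8) unfolding latin_rectangle_def by blast+
  have "(\<Sum>l\<in>{1..k}. ?e l) = lam * n ^ 2 - lam * n * r"
    using M(2) by (simp only: sum_subtractf_nat sum_occ[OF M(1)] assms(7))
  also have "\<dots> = (\<Sum>j\<in>{1..n}. lam * (n - r))"
    by (simp add: power2_eq_square algebra_simps diff_mult_distrib2)
  finally have total: "(\<Sum>j\<in>{1..n}. lam * (n - r)) = (\<Sum>l\<in>{1..k}. ?e l)"
    by simp
  have "cut_condition {1..n} {1..k} (\<lambda>_. lam * (n - r)) ?e ?u"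
    unfolding cut_condition_def
  proof (intro allI impI)
    fix J K
    assume JK: "J \<subseteq> {1..n}" "K \<subseteq> {1..k}"
    have "(\<Sum>j\<in>J. lam * (n - r))
        \<le> (\<Sum>j\<in>J. (\<Sum>l\<in>K. ?u j l) + (lam * (n - r) - (\<Sum>l\<in>K. ?u j l)))"
      by (intro sum_mono) linarith
    also have "\<dots> = (\<Sum>j\<in>J. \<Sum>l\<in>K. ?u j l) + (\<Sum>j\<in>J. lam * (n - r) - (\<Sum>l\<in>K. ?u j l))"
      by (rule sum.distrib)
    also have "(\<Sum>j\<in>J. lam * (n - r) - (\<Sum>l\<in>K. ?u j l))
        \<le> (\<Sum>j\<in>{1..n}. lam * (n - r) - (\<Sum>l\<in>K. ?u j l))"
      using JK by (intro sum_mono2) auto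
    also have "\<dots> \<le> sum ?e ({1..k} - K)"
      using cuts[OF JK(2)] .
    finally show "(\<Sum>j\<in>J. lam * (n - r)) \<le> (\<Sum>j\<in>J. \<Sum>l\<in>K. ?u j l) + sum ?e ({1..k} - K)"
      by simp
  qed
  from transportation[OF finite_atLeastAtMost finite_atLeastAtMost total this]
  obtain b where b: "\<And>j l. b j l \<le> ?u j l"
    "\<And>j. j \<in> {1..n} \<Longrightarrow> (\<Sum>l\<in>{1..k}. b j l) = lam * (n - r)"
    "\<And>l. l \<in> {1..k} \<Longrightarrow> (\<Sum>j\<in>{1..n}. b j l) = ?e l"
    by blast
  show ?extendable
    by (rule extension_from_added_counts[OF assms(4,5,8,9) b defect])
qed

end
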